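(* Let $p>3$ be a prime and let $L/K$ be a separable field extension of degree $p^3$. If $L/K$ has a Hopf Galois structure of type $C_{p^2}\times C_p$, then $L/K$ has no Hopf Galois structure of type $C_p\times C_p\times C_p$.
   Context: $C_m$ denotes the cyclic group of order $m$. A Hopf Galois structure on a finite field extension $L/K$ is a pair $(\mathcal{H},\mu)$, where $\mathcal{H}$ is a finite cocommutative $K$-Hopf algebra and $\mu:\mathcal{H}\to \operatorname{End}_K(L)$ is a $K$-linear map giving $L$ a left $\mathcal{H}$-module algebra structure and inducing a $K$-vector space isomorphism $L\otimes_K \mathcal{H}\to \operatorname{End}_K(L)$. Let $L/K$ be finite separable of degree $g$ with normal closure $\widetilde{L}$, $G=\operatorname{Gal}(\widetilde{L}/K)$, $G'=\operatorname{Gal}(\widetilde{L}/L)$, and let $\lambda:G\hookrightarrow \operatorname{Sym}(G/G')\cong S_g$ be the action of $G$ on the left cosets $G/G'$. By the theorem of Greither and Pareigis, isomorphism classes of Hopf Galois structures on $L/K$ are in bijection with regular subgroups $N$ of $\operatorname{Sym}(G/G')$ normalized by $\lambda(G)$ (the Hopf algebra corresponding to $N$ is $\widetilde{L}[N]^G$, with $G$ acting on $\widetilde{L}$ by automorphisms and on $N$ by conjugation through $\lambda$). The type of a Hopf Galois structure is the isomorphism class of the corresponding group $N$. *)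

theory Defs
  imports "HOL-Algebra.Algebra"
begin

section \<open>Linear maps, endomorphism algebras and tensor products\<close>

text \<open>The regular module of a ring. A subfield L of a ring M is the structure
  M with carrier L; as a vector space over K it is the regular module of that structure, with
  scalars restricted to K.\<close>

definition regular_module :: "('a, 'm) ring_scheme \<Rightarrow> ('a, 'a) module" where
  "regular_module R =
     \<lparr>carrier = carrier R, monoid.mult = monoid.mult R, one = one R,
      ring.zero = ring.zero R, ring.add = ring.add R, smult = monoid.mult R\<rparr>"

definition linear_map ::
  "('k, 'm) ring_scheme \<Rightarrow> ('k, 'a, 'n) module_scheme \<Rightarrow> ('k, 'b, 'q) module_scheme
    \<Rightarrow> ('a \<Rightarrow> 'b) \<Rightarrow> bool" where
  "linear_map R A B f \<longleftrightarrow>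
     f \<in> carrier A \<rightarrow> carrier B \<and>
     (\<forall>x\<in>carrier A. \<forall>y\<in>carrier A. f (x \<oplus>\<^bsub>A\<^esub> y) = f x \<oplus>\<^bsub>B\<^esub> f y) \<and>
     (\<forall>c\<in>carrier R. \<forall>x\<in>carrier A. f (c \<odot>\<^bsub>A\<^esub> x) = c \<odot>\<^bsub>B\<^esub> f x)"

definition linear_iso ::
  "('k, 'm) ring_scheme \<Rightarrow> ('k, 'a, 'n) module_scheme \<Rightarrow> ('k, 'b, 'q) module_scheme
    \<Rightarrow> ('a \<Rightarrow> 'b) \<Rightarrow> bool" where
  "linear_iso R A B f \<longleftrightarrow> linear_map R A B f \<and> bij_betw f (carrier A) (carrier B)"

definition finitely_generated :: "('k, 'm) ring_scheme \<Rightarrow> ('k, 'a, 'n) module_scheme \<Rightarrow> bool" where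
  "finitely_generated R A \<longleftrightarrow>
     (\<exists>B. finite B \<and> B \<subseteq> carrier A \<and>
        (\<forall>x\<in>carrier A. \<exists>c\<in>B \<rightarrow> carrier R. x = (\<Oplus>\<^bsub>A\<^esub>b\<in>B. c b \<odot>\<^bsub>A\<^esub> b)))"

definition End_algebra ::
  "('k, 'm) ring_scheme \<Rightarrow> ('k, 'a, 'n) module_scheme \<Rightarrow> ('k, 'a \<Rightarrow> 'a) module" where
  "End_algebra R V =
     \<lparr>carrier = {f \<in> extensional (carrier V). linear_map R V V f},
      monoid.mult = (\<lambda>f g. compose (carrier V) f g),
      one = (\<lambda>x\<in>carrier V. x),
      ring.zero = (\<lambda>x\<in>carrier V. \<zero>\<^bsub>V\<^esub>),
      ring.add = (\<lambda>f g. \<lambda>x\<in>carrier V. f x \<oplus>\<^bsub>V\<^esub> g x),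
      smult = (\<lambda>c f. \<lambda>x\<in>carrier V. c \<odot>\<^bsub>V\<^esub> f x)\<rparr>"

text \<open>The tensor product is the quotient of the free module on pairs by the submodule generated
  by the bilinearity relations, so its elements are additive cosets. In the two auxiliary module
  structures below the multiplicative fields of the record play no role.\<close>

definition free_module :: "('k, 'm) ring_scheme \<Rightarrow> 'x set \<Rightarrow> ('k, 'x \<Rightarrow> 'k) module" where
  "free_module R S =
     \<lparr>carrier = {u. (\<forall>x. u x \<in> carrier R) \<and> (\<forall>x. x \<notin> S \<longrightarrow> u x = \<zero>\<^bsub>R\<^esub>) \<and> finite {x. u x \<noteq> \<zero>\<^bsub>R\<^esub>}},
      monoid.mult = undefined, one = undefined,
      ring.zero = (\<lambda>x. \<zero>\<^bsub>R\<^esub>),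
      ring.add = (\<lambda>u v x. u x \<oplus>\<^bsub>R\<^esub> v x),
      smult = (\<lambda>c u x. c \<otimes>\<^bsub>R\<^esub> u x)\<rparr>"

definition free_gen :: "('k, 'm) ring_scheme \<Rightarrow> 'x \<Rightarrow> 'x \<Rightarrow> 'k" where
  "free_gen R x = (\<lambda>y. if y = x then \<one>\<^bsub>R\<^esub> else \<zero>\<^bsub>R\<^esub>)"

abbreviation pairs_module ::
  "('k, 'm) ring_scheme \<Rightarrow> ('k, 'a, 'n) module_scheme \<Rightarrow> ('k, 'b, 'q) module_scheme
    \<Rightarrow> ('k, 'a \<times> 'b \<Rightarrow> 'k) module" where
  "pairs_module R A B \<equiv> free_module R (carrier A \<times> carrier B)"

inductive_set bilinearity_relations ::
  "('k, 'm) ring_scheme \<Rightarrow> ('k, 'a, 'n) module_scheme \<Rightarrow> ('k, 'b, 'q) module_scheme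
    \<Rightarrow> ('a \<times> 'b \<Rightarrow> 'k) set"
  for R and A and B where
  add_left: "\<lbrakk>a \<in> carrier A; a' \<in> carrier A; b \<in> carrier B\<rbrakk> \<Longrightarrow>
      free_gen R (a \<oplus>\<^bsub>A\<^esub> a', b)
        \<ominus>\<^bsub>pairs_module R A B\<^esub> (free_gen R (a, b) \<oplus>\<^bsub>pairs_module R A B\<^esub> free_gen R (a', b))
      \<in> bilinearity_relations R A B"
| add_right: "\<lbrakk>a \<in> carrier A; b \<in> carrier B; b' \<in> carrier B\<rbrakk> \<Longrightarrow>
      free_gen R (a, b \<oplus>\<^bsub>B\<^esub> b')
        \<ominus>\<^bsub>pairs_module R A B\<^esub> (free_gen R (a, b) \<oplus>\<^bsub>pairs_module R A B\<^esub> free_gen R (a, b'))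
      \<in> bilinearity_relations R A B"
| smult_left: "\<lbrakk>c \<in> carrier R; a \<in> carrier A; b \<in> carrier B\<rbrakk> \<Longrightarrow>
      free_gen R (c \<odot>\<^bsub>A\<^esub> a, b) \<ominus>\<^bsub>pairs_module R A B\<^esub> (c \<odot>\<^bsub>pairs_module R A B\<^esub> free_gen R (a, b))
      \<in> bilinearity_relations R A B"
| smult_right: "\<lbrakk>c \<in> carrier R; a \<in> carrier A; b \<in> carrier B\<rbrakk> \<Longrightarrow>
      free_gen R (a, c \<odot>\<^bsub>B\<^esub> b) \<ominus>\<^bsub>pairs_module R A B\<^esub> (c \<odot>\<^bsub>pairs_module R A B\<^esub> free_gen R (a, b))
      \<in> bilinearity_relations R A B"

definition tensor_null ::
  "('k, 'm) ring_scheme \<Rightarrow> ('k, 'a, 'n) module_scheme \<Rightarrow> ('k, 'b, 'q) module_scheme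
    \<Rightarrow> ('a \<times> 'b \<Rightarrow> 'k) set" where
  "tensor_null R A B =
     \<Inter>{N. submodule N R (pairs_module R A B) \<and> bilinearity_relations R A B \<subseteq> N}"

definition tensor_class ::
  "('k, 'm) ring_scheme \<Rightarrow> ('k, 'a, 'n) module_scheme \<Rightarrow> ('k, 'b, 'q) module_scheme
    \<Rightarrow> ('a \<times> 'b \<Rightarrow> 'k) \<Rightarrow> ('a \<times> 'b \<Rightarrow> 'k) set" where
  "tensor_class R A B u = tensor_null R A B +>\<^bsub>pairs_module R A B\<^esub> u"

definition pure_tensor ::
  "('k, 'm) ring_scheme \<Rightarrow> ('k, 'a, 'n) module_scheme \<Rightarrow> ('k, 'b, 'q) module_scheme
    \<Rightarrow> 'a \<Rightarrow> 'b \<Rightarrow> ('a \<times> 'b \<Rightarrow> 'k) set" where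
  "pure_tensor R A B a b = tensor_class R A B (free_gen R (a, b))"

definition tensor_module ::
  "('k, 'm) ring_scheme \<Rightarrow> ('k, 'a, 'n) module_scheme \<Rightarrow> ('k, 'b, 'q) module_scheme
    \<Rightarrow> ('k, ('a \<times> 'b \<Rightarrow> 'k) set) module" where
  "tensor_module R A B =
     \<lparr>carrier = a_rcosets\<^bsub>pairs_module R A B\<^esub> (tensor_null R A B),
      monoid.mult = undefined, one = undefined,
      ring.zero = tensor_null R A B,
      ring.add = (\<lambda>S S'. S <+>\<^bsub>pairs_module R A B\<^esub> S'),
      smult = (\<lambda>c S. \<Union>u\<in>S. tensor_class R A B (c \<odot>\<^bsub>pairs_module R A B\<^esub> u))\<rparr>"

text \<open>For a bilinear map \<open>\<beta>\<close>, the induced linear map from the tensor product to C, which sends the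
  class of a formal sum of pairs (a, b) to the sum of the values of \<open>\<beta>\<close>. Bilinearity makes it
  independent of the chosen representative.\<close>

definition tensor_lift ::
  "('k, 'm) ring_scheme \<Rightarrow> ('k, 'a, 'n) module_scheme \<Rightarrow> ('k, 'b, 'q) module_scheme
    \<Rightarrow> ('k, 'c, 'r) module_scheme \<Rightarrow> ('a \<Rightarrow> 'b \<Rightarrow> 'c) \<Rightarrow> ('a \<times> 'b \<Rightarrow> 'k) set \<Rightarrow> 'c" where
  "tensor_lift R A B C \<beta> S =
     (let u = (SOME u. u \<in> S)
      in \<Oplus>\<^bsub>C\<^esub>z\<in>{z. u z \<noteq> \<zero>\<^bsub>R\<^esub>}. u z \<odot>\<^bsub>C\<^esub> \<beta> (fst z) (snd z))"

definition tensor ::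
  "('k, 'm) ring_scheme \<Rightarrow> ('k, 'a, 'n) module_scheme \<Rightarrow> ('k, 'b, 'q) module_scheme
    \<Rightarrow> ('k, ('a \<times> 'b \<Rightarrow> 'k) set) module" where
  "tensor R A B = (tensor_module R A B)
     \<lparr>monoid.mult := (\<lambda>S S'. tensor_lift R A B (tensor_module R A B)
                (\<lambda>a b. tensor_lift R A B (tensor_module R A B)
                   (\<lambda>a' b'. pure_tensor R A B (a \<otimes>\<^bsub>A\<^esub> a') (b \<otimes>\<^bsub>B\<^esub> b')) S') S),
      one := pure_tensor R A B \<one>\<^bsub>A\<^esub> \<one>\<^bsub>B\<^esub>\<rparr>"

section \<open>Hopf algebras\<close>

record ('k, 'h) hopf = "('k, 'h) module" +
  comult :: "'h \<Rightarrow> ('h \<times> 'h \<Rightarrow> 'k) set"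
  counit :: "'h \<Rightarrow> 'k"
  antipode :: "'h \<Rightarrow> 'h"

text \<open>The library locale \<open>algebra\<close> requires commutativity, which Hopf algebras need not have.
  Coassociativity is stated after moving both sides to the tensor product of H with the
  tensor product of H with itself.\<close>

locale hopf_algebra = module R H + ring H
  for R :: "('k, 'm) ring_scheme" (structure) and H :: "('k, 'h, 'n) hopf_scheme" (structure) +
  assumes smult_mult_left:
      "\<lbrakk>c \<in> carrier R; x \<in> carrier H; y \<in> carrier H\<rbrakk> \<Longrightarrow>
        (c \<odot>\<^bsub>H\<^esub> x) \<otimes>\<^bsub>H\<^esub> y = c \<odot>\<^bsub>H\<^esub> (x \<otimes>\<^bsub>H\<^esub> y)"
    and smult_mult_right:
      "\<lbrakk>c \<in> carrier R; x \<in> carrier H; y \<in> carrier H\<rbrakk> \<Longrightarrow>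
        x \<otimes>\<^bsub>H\<^esub> (c \<odot>\<^bsub>H\<^esub> y) = c \<odot>\<^bsub>H\<^esub> (x \<otimes>\<^bsub>H\<^esub> y)"
    and comult_hom: "comult H \<in> ring_hom H (tensor R H H)"
    and comult_linear: "linear_map R H (tensor R H H) (comult H)"
    and counit_hom: "counit H \<in> ring_hom H R"
    and counit_linear: "linear_map R H (regular_module R) (counit H)"
    and antipode_linear: "linear_map R H H (antipode H)"
    and coassoc:
      "h \<in> carrier H \<Longrightarrow>
        tensor_lift R H H (tensor R H (tensor R H H))
          (\<lambda>a b. tensor_lift R H H (tensor R H (tensor R H H))
             (\<lambda>a\<^sub>1 a\<^sub>2. pure_tensor R H (tensor R H H) a\<^sub>1 (pure_tensor R H H a\<^sub>2 b)) (comult H a))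
          (comult H h)
        = tensor_lift R H H (tensor R H (tensor R H H))
            (\<lambda>a b. pure_tensor R H (tensor R H H) a (comult H b)) (comult H h)"
    and counit_left:
      "h \<in> carrier H \<Longrightarrow> tensor_lift R H H H (\<lambda>a b. counit H a \<odot>\<^bsub>H\<^esub> b) (comult H h) = h"
    and counit_right:
      "h \<in> carrier H \<Longrightarrow> tensor_lift R H H H (\<lambda>a b. counit H b \<odot>\<^bsub>H\<^esub> a) (comult H h) = h"
    and antipode_left:
      "h \<in> carrier H \<Longrightarrow>
        tensor_lift R H H H (\<lambda>a b. antipode H a \<otimes>\<^bsub>H\<^esub> b) (comult H h) = counit H h \<odot>\<^bsub>H\<^esub> \<one>\<^bsub>H\<^esub>"
    and antipode_right:
      "h \<in> carrier H \<Longrightarrow>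
        tensor_lift R H H H (\<lambda>a b. a \<otimes>\<^bsub>H\<^esub> antipode H b) (comult H h) = counit H h \<odot>\<^bsub>H\<^esub> \<one>\<^bsub>H\<^esub>"

locale cocommutative_hopf_algebra = hopf_algebra +
  assumes cocomm:
    "h \<in> carrier H \<Longrightarrow>
      tensor_lift R H H (tensor R H H) (\<lambda>a b. pure_tensor R H H b a) (comult H h) = comult H h"

definition hopf_iso ::
  "('k, 'm) ring_scheme \<Rightarrow> ('k, 'a, 'n) hopf_scheme \<Rightarrow> ('k, 'b, 'q) hopf_scheme
    \<Rightarrow> ('a \<Rightarrow> 'b) \<Rightarrow> bool" where
  "hopf_iso R A B f \<longleftrightarrow>
     linear_iso R A B f \<and> f \<in> ring_hom A B \<and>
     (\<forall>h\<in>carrier A.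
        comult B (f h)
          = tensor_lift R A A (tensor R B B) (\<lambda>a b. pure_tensor R B B (f a) (f b)) (comult A h) \<and>
        counit B (f h) = counit A h \<and>
        antipode B (f h) = f (antipode A h))"

section \<open>Hopf Galois structures\<close>

text \<open>All fields are subfields of a field M, which is the normal closure of L/K in the application.\<close>

abbreviation subfield_ring :: "('a, 'm) ring_scheme \<Rightarrow> 'a set \<Rightarrow> ('a, 'm) ring_scheme" where
  "subfield_ring M K \<equiv> M\<lparr>carrier := K\<rparr>"

abbreviation subfield_module :: "('a, 'm) ring_scheme \<Rightarrow> 'a set \<Rightarrow> ('a, 'a) module" where
  "subfield_module M L \<equiv> regular_module (subfield_ring M L)"

text \<open>The last conjunct concerns the K-linear map from the tensor product of L and H to the
  endomorphisms of L that sends the class of (s, h) to the map x to s times h(x).\<close>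

definition hopf_galois_structure ::
  "('a, 'm) ring_scheme \<Rightarrow> 'a set \<Rightarrow> 'a set \<Rightarrow> ('a, 'h, 'n) hopf_scheme \<Rightarrow> ('h \<Rightarrow> 'a \<Rightarrow> 'a) \<Rightarrow> bool"
  where
  "hopf_galois_structure M K L H \<mu> \<longleftrightarrow>
     cocommutative_hopf_algebra (subfield_ring M K) H \<and>
     finitely_generated (subfield_ring M K) H \<and>
     \<mu> \<in> ring_hom H (End_algebra (subfield_ring M K) (subfield_module M L)) \<and>
     linear_map (subfield_ring M K) H (End_algebra (subfield_ring M K) (subfield_module M L)) \<mu> \<and>
     (\<forall>h\<in>carrier H. \<forall>x\<in>L. \<forall>y\<in>L.
        \<mu> h (x \<otimes>\<^bsub>M\<^esub> y)
          = tensor_lift (subfield_ring M K) H H (subfield_module M L)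
              (\<lambda>h\<^sub>1 h\<^sub>2. \<mu> h\<^sub>1 x \<otimes>\<^bsub>M\<^esub> \<mu> h\<^sub>2 y) (comult H h)) \<and>
     (\<forall>h\<in>carrier H. \<mu> h \<one>\<^bsub>M\<^esub> = counit H h \<otimes>\<^bsub>M\<^esub> \<one>\<^bsub>M\<^esub>) \<and>
     linear_iso (subfield_ring M K)
       (tensor (subfield_ring M K) (subfield_module M L) H)
       (End_algebra (subfield_ring M K) (subfield_module M L))
       (tensor_lift (subfield_ring M K) (subfield_module M L) H
          (End_algebra (subfield_ring M K) (subfield_module M L))
          (\<lambda>s h. \<lambda>x\<in>L. s \<otimes>\<^bsub>M\<^esub> \<mu> h x))"

definition hgs_iso ::
  "('a, 'm) ring_scheme \<Rightarrow> 'a set \<Rightarrow> 'a set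
    \<Rightarrow> ('a, 'h, 'n) hopf_scheme \<Rightarrow> ('h \<Rightarrow> 'a \<Rightarrow> 'a)
    \<Rightarrow> ('a, 'j, 'q) hopf_scheme \<Rightarrow> ('j \<Rightarrow> 'a \<Rightarrow> 'a) \<Rightarrow> bool" where
  "hgs_iso M K L H \<mu> H' \<mu>' \<longleftrightarrow>
     (\<exists>f. hopf_iso (subfield_ring M K) H H' f \<and>
        (\<forall>h\<in>carrier H. \<forall>x\<in>L. \<mu>' (f h) x = \<mu> h x))"

section \<open>Separability, normal closure and Galois groups\<close>

text \<open>Separability is tested in a field M over which the minimal polynomials split.\<close>

definition separable_extension :: "('a, 'm) ring_scheme \<Rightarrow> 'a set \<Rightarrow> 'a set \<Rightarrow> bool" where
  "separable_extension M K L \<longleftrightarrow>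
     (\<forall>x\<in>L. ring.algebraic M K x \<and> ring.splitted M (ring.Irr M K x) \<and>
        (\<forall>a\<in>carrier M. ring.alg_mult M (ring.Irr M K x) a \<le> 1))"

definition is_normal_closure :: "('a, 'm) ring_scheme \<Rightarrow> 'a set \<Rightarrow> 'a set \<Rightarrow> bool" where
  "is_normal_closure M K L \<longleftrightarrow>
     (\<forall>x\<in>L. ring.algebraic M K x \<and> ring.splitted M (ring.Irr M K x)) \<and>
     carrier M = generate_field M (K \<union> {a. \<exists>x\<in>L. ring.is_root M (ring.Irr M K x) a})"

definition galois_set :: "('a, 'm) ring_scheme \<Rightarrow> 'a set \<Rightarrow> ('a \<Rightarrow> 'a) set" where
  "galois_set M F = {\<sigma> \<in> Bij (carrier M). \<sigma> \<in> ring_hom M M \<and> (\<forall>x\<in>F. \<sigma> x = x)}"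

definition galois_group :: "('a, 'm) ring_scheme \<Rightarrow> 'a set \<Rightarrow> ('a \<Rightarrow> 'a) monoid" where
  "galois_group M F = (BijGroup (carrier M))\<lparr>carrier := galois_set M F\<rparr>"

section \<open>The Greither-Pareigis correspondence\<close>

definition coset_space :: "('a, 'm) ring_scheme \<Rightarrow> 'a set \<Rightarrow> 'a set \<Rightarrow> ('a \<Rightarrow> 'a) set set" where
  "coset_space M K L = lcosets\<^bsub>galois_group M K\<^esub> (galois_set M L)"

abbreviation coset_perms ::
  "('a, 'm) ring_scheme \<Rightarrow> 'a set \<Rightarrow> 'a set \<Rightarrow> (('a \<Rightarrow> 'a) set \<Rightarrow> ('a \<Rightarrow> 'a) set) monoid" where
  "coset_perms M K L \<equiv> BijGroup (coset_space M K L)"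

definition left_translation ::
  "('a, 'm) ring_scheme \<Rightarrow> 'a set \<Rightarrow> 'a set \<Rightarrow> ('a \<Rightarrow> 'a) \<Rightarrow> ('a \<Rightarrow> 'a) set \<Rightarrow> ('a \<Rightarrow> 'a) set" where
  "left_translation M K L g = (\<lambda>C\<in>coset_space M K L. g <#\<^bsub>galois_group M K\<^esub> C)"

definition translation_conj ::
  "('a, 'm) ring_scheme \<Rightarrow> 'a set \<Rightarrow> 'a set \<Rightarrow> ('a \<Rightarrow> 'a)
    \<Rightarrow> (('a \<Rightarrow> 'a) set \<Rightarrow> ('a \<Rightarrow> 'a) set) \<Rightarrow> ('a \<Rightarrow> 'a) set \<Rightarrow> ('a \<Rightarrow> 'a) set" where
  "translation_conj M K L g n =
     left_translation M K L g \<otimes>\<^bsub>coset_perms M K L\<^esub> n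
       \<otimes>\<^bsub>coset_perms M K L\<^esub> inv\<^bsub>coset_perms M K L\<^esub> (left_translation M K L g)"

definition regular_subgroup :: "('x \<Rightarrow> 'x) set \<Rightarrow> 'x set \<Rightarrow> bool" where
  "regular_subgroup N S \<longleftrightarrow>
     subgroup N (BijGroup S) \<and> (\<forall>x\<in>S. \<forall>y\<in>S. \<exists>!n. n \<in> N \<and> n x = y)"

definition normalized_by_galois ::
  "('a, 'm) ring_scheme \<Rightarrow> 'a set \<Rightarrow> 'a set \<Rightarrow> (('a \<Rightarrow> 'a) set \<Rightarrow> ('a \<Rightarrow> 'a) set) set \<Rightarrow> bool" where
  "normalized_by_galois M K L N \<longleftrightarrow>
     (\<forall>g\<in>galois_set M K. translation_conj M K L g ` N = N)"

text \<open>The K-algebra of fixed points of the group algebra of N over M, where the Galois group acts on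
  M by automorphisms and on N by conjugation. An element of the group algebra is its coefficient
  function on N, and the product is convolution.\<close>

definition gp_algebra ::
  "('a, 'm) ring_scheme \<Rightarrow> 'a set \<Rightarrow> 'a set \<Rightarrow> (('a \<Rightarrow> 'a) set \<Rightarrow> ('a \<Rightarrow> 'a) set) set
    \<Rightarrow> ('a, (('a \<Rightarrow> 'a) set \<Rightarrow> ('a \<Rightarrow> 'a) set) \<Rightarrow> 'a) module" where
  "gp_algebra M K L N =
     \<lparr>carrier = {c \<in> N \<rightarrow>\<^sub>E carrier M.
        \<forall>g\<in>galois_set M K. \<forall>n\<in>N. c (translation_conj M K L g n) = g (c n)},
      monoid.mult = (\<lambda>c d. \<lambda>n\<in>N. \<Oplus>\<^bsub>M\<^esub>m\<in>N.
        c m \<otimes>\<^bsub>M\<^esub> d (inv\<^bsub>coset_perms M K L\<^esub> m \<otimes>\<^bsub>coset_perms M K L\<^esub> n)),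
      one = (\<lambda>n\<in>N. if n = \<one>\<^bsub>coset_perms M K L\<^esub> then \<one>\<^bsub>M\<^esub> else \<zero>\<^bsub>M\<^esub>),
      ring.zero = (\<lambda>n\<in>N. \<zero>\<^bsub>M\<^esub>),
      ring.add = (\<lambda>c d. \<lambda>n\<in>N. c n \<oplus>\<^bsub>M\<^esub> d n),
      smult = (\<lambda>k c. \<lambda>n\<in>N. k \<otimes>\<^bsub>M\<^esub> c n)\<rparr>"

text \<open>The elements n of N are group-like in the group algebra over M, and the comultiplication of the
  fixed algebra H is the restriction of that one: by Galois descent the tensor product of H with
  itself over K embeds into the group algebra of the product of N with N over M, and the
  comultiplication of c is the unique element whose coefficient at (n, m) is c(n) if n = m and
  0 otherwise.\<close>

definition gp_hopf_algebra ::
  "('a, 'm) ring_scheme \<Rightarrow> 'a set \<Rightarrow> 'a set \<Rightarrow> (('a \<Rightarrow> 'a) set \<Rightarrow> ('a \<Rightarrow> 'a) set) set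
    \<Rightarrow> ('a, (('a \<Rightarrow> 'a) set \<Rightarrow> ('a \<Rightarrow> 'a) set) \<Rightarrow> 'a) hopf" where
  "gp_hopf_algebra M K L N = module.extend (gp_algebra M K L N)
     (hopf.fields
       (\<lambda>c. THE S. S \<in> carrier (tensor (subfield_ring M K) (gp_algebra M K L N) (gp_algebra M K L N)) \<and>
          (\<forall>n\<in>N. \<forall>m\<in>N.
             tensor_lift (subfield_ring M K) (gp_algebra M K L N) (gp_algebra M K L N)
               (regular_module M) (\<lambda>a b. a n \<otimes>\<^bsub>M\<^esub> b m) S
             = (if n = m then c n else \<zero>\<^bsub>M\<^esub>)))
       (\<lambda>c. \<Oplus>\<^bsub>M\<^esub>n\<in>N. c n)
       (\<lambda>c. \<lambda>n\<in>N. c (inv\<^bsub>coset_perms M K L\<^esub> n)))"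

text \<open>An element of N acts on functions on the coset space by \<open>(n f) C = f (n\<inverse> C)\<close>, and x in L is
  identified with the function that sends the coset of \<open>\<sigma>\<close> to \<open>\<sigma> x\<close>. Evaluating at the trivial
  coset gives the action of the fixed algebra on L.\<close>

definition gp_action ::
  "('a, 'm) ring_scheme \<Rightarrow> 'a set \<Rightarrow> 'a set \<Rightarrow> (('a \<Rightarrow> 'a) set \<Rightarrow> ('a \<Rightarrow> 'a) set) set
    \<Rightarrow> ((('a \<Rightarrow> 'a) set \<Rightarrow> ('a \<Rightarrow> 'a) set) \<Rightarrow> 'a) \<Rightarrow> 'a \<Rightarrow> 'a" where
  "gp_action M K L N c = (\<lambda>x\<in>L. \<Oplus>\<^bsub>M\<^esub>n\<in>N.
     c n \<otimes>\<^bsub>M\<^esub> (SOME \<sigma>. \<sigma> \<in> (inv\<^bsub>coset_perms M K L\<^esub> n) (galois_set M L)) x)"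

definition has_type ::
  "('a, 'm) ring_scheme \<Rightarrow> 'a set \<Rightarrow> 'a set \<Rightarrow> ('a, 'h, 'n) hopf_scheme \<Rightarrow> ('h \<Rightarrow> 'a \<Rightarrow> 'a)
    \<Rightarrow> ('t, 'u) monoid_scheme \<Rightarrow> bool" where
  "has_type M K L H \<mu> T \<longleftrightarrow>
     (\<exists>N. regular_subgroup N (coset_space M K L) \<and> normalized_by_galois M K L N \<and>
        hgs_iso M K L H \<mu> (gp_hopf_algebra M K L N) (gp_action M K L N) \<and>
        (coset_perms M K L)\<lparr>carrier := N\<rparr> \<cong> T)"

text \<open>The type argument is the type in which the carrier of the Hopf algebra lives.\<close>

definition has_hopf_galois_structure_of_type ::
  "'h itself \<Rightarrow> ('a, 'm) ring_scheme \<Rightarrow> 'a set \<Rightarrow> 'a set \<Rightarrow> ('t, 'u) monoid_scheme \<Rightarrow> bool" where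
  "has_hopf_galois_structure_of_type TYPE('h) M K L T \<longleftrightarrow>
     (\<exists>(H :: ('a, 'h) hopf) \<mu>. hopf_galois_structure M K L H \<mu> \<and> has_type M K L H \<mu> T)"

end

theory Submission
  imports Defs
begin

text \<open>A structure of either type yields a regular subgroup of the permutations of the \<open>p\<^sup>3\<close> cosets
  that is normalized by the transitive Galois group. Let P be a Sylow p-subgroup of the
  intersection of the normalizers of the two regular subgroups; it is still transitive. Take g in P,
  a point x, and write \<open>g = n h\<close> with n in one of the regular groups N and h fixing x. Put
  \<open>\<delta> = \<phi> - 1\<close>, where \<open>\<phi>\<close> is conjugation by g on N. Since \<open>\<phi>\<close> has p-power order, each application
  of \<open>\<delta>\<close> shrinks invariant subgroups, so \<open>\<delta>\<^sup>3 = 0\<close>, and \<open>p\<delta> = 0\<close> because pN has order at most p. Hence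
  the norm \<open>1 + \<phi> + ... + \<phi>\<^bsup>p-1\<^esup> = p + (p choose 2)\<delta> + (p choose 3)\<delta>\<^sup>2\<close> is multiplication by p when
  \<open>p > 3\<close>, that is, \<open>g\<^bsup>p\<^esup>x = n\<^bsup>p\<^esup>x\<close>. The elementary abelian group forces \<open>g\<^bsup>p\<^esup> = 1\<close> for all g in P, and
  then the other group would have exponent p as well.\<close>

section \<open>Fixed points of p-group actions and transitive Sylow subgroups\<close>

text \<open>Orbit sizes divide the group order and hence are powers of p. If \<open>{e}\<close> were
  the only orbit of size 1, all others would have size divisible by p, and \<open>card E\<close>
  would be 1 modulo p.\<close>

lemma p_group_action_second_fixed_point:
  assumes "group_action G E \<phi>" and p: "Factorial_Ring.prime (p::nat)" and ord: "order G = p ^ k"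
    and E: "finite E" "p dvd card E" "e \<in> E" and e: "\<And>g. g \<in> carrier G \<Longrightarrow> \<phi> g e = e"
  obtains x where "x \<in> E" "x \<noteq> e" "\<And>g. g \<in> carrier G \<Longrightarrow> \<phi> g x = x"
proof -
  interpret group_action G E \<phi> by fact
  have grp: "group G"
    using group_hom group_hom.axioms(1) by blast
  have oe: "orbit G \<phi> e = {e}"
    using e[symmetric] monoid.one_closed[OF group.is_monoid[OF grp]] e unfolding orbit_def by blast
  have "\<exists>x\<in>E. x \<noteq> e \<and> orbit G \<phi> x = {x}"
  proof (rule ccontr)
    assume *: "\<not> ?thesis"
    have "p dvd card B" if B: "B \<in> orbits G E \<phi> - {{e}}" for B
    proof -
      obtain x where x: "x \<in> E" "B = orbit G \<phi> x" "B \<noteq> {e}"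
        using B by (auto simp: orbits_def)
      have "card B dvd p ^ k"
        using orbit_stabilizer_theorem[OF x(1)] ord x(2) by (metis dvd_triv_left)
      then obtain i where i: "card B = p ^ i"
        using divides_primepow_nat[OF p] by blast
      have "card B \<noteq> 1"
      proof
        assume "card B = 1"
        then obtain y where "B = {y}"
          by (rule card_1_singletonE)
        then have "orbit G \<phi> x = {x}"
          using x(2) orbit_refl[OF x(1)] by auto
        then show False
          using x * oe by metis
      qed
      then show ?thesis using i by (cases i) auto
    qed
    then have "p dvd (\<Sum>B\<in>orbits G E \<phi> - {{e}}. card B)"
      by (rule dvd_sum)
    moreover have "card E = (\<Sum>B\<in>orbits G E \<phi>. card B)"
      using disjoint_sum[OF E(1), of "\<lambda>_. 1::nat"] by simp
    moreover have "(\<Sum>B\<in>orbits G E \<phi>. card B) = card {e} + (\<Sum>B\<in>orbits G E \<phi> - {{e}}. card B)"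
    proof (rule sum.remove)
      have "orbits G E \<phi> = orbit G \<phi> ` E"
        by (auto simp: orbits_def)
      then show "finite (orbits G E \<phi>)" "{e} \<in> orbits G E \<phi>"
        using E oe by auto
    qed
    ultimately have "p dvd 1"
      using E(2) by (metis card_1_singleton_iff dvd_add_left_iff One_nat_def)
    then show False using p by auto
  qed
  then obtain x where x: "x \<in> E" "x \<noteq> e" "orbit G \<phi> x = {x}" by blast
  show thesis
    by (rule that[OF x(1,2)]) (use x(3) in \<open>auto simp: orbit_def\<close>)
qed

text \<open>The iterates of \<open>f\<close> define an action on \<open>E\<close> of the integers
  modulo \<open>p ^ k\<close>, so the previous lemma applies; a point fixed by the class of 1 is
  fixed by \<open>f\<close>.\<close>

lemma funpow_fixed_point_prime_power_period:
  assumes p: "Factorial_Ring.prime (p::nat)" and f: "\<And>x. x \<in> E \<Longrightarrow> f x \<in> E"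
    and per: "\<And>x. x \<in> E \<Longrightarrow> (f ^^ (p ^ k)) x = x"
    and E: "finite E" "p dvd card E" "e \<in> E" "f e = e"
  obtains x where "x \<in> E" "x \<noteq> e" "f x = x"
\<comment> \<open>The general argument evaluates the action at 1, which is not in the carrier of the
  integers modulo 1. For \<open>k = 0\<close>, however, \<open>f\<close> is the identity on
  \<open>E\<close>, and any second point will do.\<close>
proof (cases "k = 0")
  case True
  have "\<exists>x\<in>E. x \<noteq> e"
  proof (rule ccontr)
    assume "\<not> ?thesis"
    then have "E = {e}" using E(3) by blast
    then show False using E(2) p by auto
  qed
  then obtain x where x: "x \<in> E" "x \<noteq> e" by blast
  show ?thesis
    by (rule that[OF x]) (use per[OF x(1)] True in simp)
next
  case False
  \<comment> \<open>The group consists of integers, hence \<open>nat\<close>; the restriction to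
    \<open>E\<close> is there because members of \<open>Bij E\<close> are extensional.\<close>
  define \<psi> where "\<psi> i = (\<lambda>x\<in>E. (f ^^ nat i) x)" for i
  let ?Z = "integer_mod_group (p ^ k)"
  have cl: "(f ^^ n) x \<in> E" if "x \<in> E" for x n
    using that by (induction n) (auto intro: f)
  have p0: "p ^ k > 0" "p ^ k > 1"
    using one_less_power[of p k] prime_gt_1_nat[OF p] False by auto
  have add: "(f ^^ nat i) ((f ^^ nat j) x) = (f ^^ nat ((i + j) mod int (p ^ k))) x"
    if "x \<in> E" "i \<ge> 0" "j \<ge> 0" for x i j
  proof -
    have "nat ((i + j) mod int (p ^ k)) = (nat i + nat j) mod p ^ k"
      using that by (simp add: nat_mod_distrib nat_add_distrib flip: of_nat_power)
    then show ?thesis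
      using funpow_mod_eq[OF per[OF that(1)]] by (simp add: funpow_add)
  qed
  have inv: "(f ^^ nat i) ((f ^^ nat ((- i) mod int (p ^ k))) x) = x" "(f ^^ nat ((- i) mod int (p ^ k))) ((f ^^ nat i) x) = x"
    if "x \<in> E" "i \<ge> 0" for x i
    using that p0 by (simp_all add: add mod_simps del: of_nat_power)
  have bij: "\<psi> i \<in> Bij E" if "i \<ge> 0" for i
    unfolding Bij_def \<psi>_def
    by (auto intro!: bij_betw_byWitness[where f' = "\<lambda>x. (f ^^ nat ((- i) mod int (p ^ k))) x"] simp: inv cl that
        simp del: of_nat_power)
  have "group_action ?Z E \<psi>"
    unfolding group_action_def group_hom_def group_hom_axioms_def
  proof (intro conjI)
    show "\<psi> \<in> hom ?Z (BijGroup E)"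
    proof (rule homI)
      fix i j assume "i \<in> carrier ?Z" "j \<in> carrier ?Z"
      then have ij: "i \<ge> 0" "j \<ge> 0"
        using p0 by (auto simp: carrier_integer_mod_group split: if_splits)
      show "\<psi> (i \<otimes>\<^bsub>?Z\<^esub> j) = \<psi> i \<otimes>\<^bsub>BijGroup E\<^esub> \<psi> j"
        using bij[OF ij(1)] bij[OF ij(2)]
        by (auto simp: BijGroup_def fun_eq_iff compose_def \<psi>_def add ij cl)
    qed (use bij p0 in \<open>auto simp: BijGroup_def carrier_integer_mod_group split: if_splits\<close>)
  qed (auto simp: group_BijGroup)
  moreover have "order ?Z = p ^ k"
    using p0 by (simp add: order_def carrier_integer_mod_group nat_power_eq)
  moreover have "\<psi> i e = e" for i
  proof -
    have "(f ^^ n) e = e" for n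
      by (induction n) (auto simp: E)
    then show ?thesis using E by (simp add: \<psi>_def)
  qed
  ultimately obtain x where x: "x \<in> E" "x \<noteq> e" "\<And>g. g \<in> carrier ?Z \<Longrightarrow> \<psi> g x = x"
    using p_group_action_second_fixed_point[of ?Z E \<psi> p k e] p E(1-3) by metis
  have "1 \<in> carrier ?Z"
    using p0(2) by (metis integer_mod_group_1 less_irrefl)
  from x(3)[OF this] have "f x = x"
    using x(1) by (simp add: \<psi>_def)
  then show ?thesis using x that by blast
qed

text \<open>Let \<open>p ^ b\<close> be the order of the stabilizer of \<open>x\<close> in
  \<open>P\<close>. It divides the order of the stabilizer in \<open>G\<close>, so
  \<open>p ^ (n + b)\<close> divides \<open>p ^ a * m\<close> and therefore \<open>p ^ a\<close>. As
  \<open>p ^ a\<close> is also the size of the orbit under \<open>P\<close> times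
  \<open>p ^ b\<close>, that orbit has at least \<open>p ^ n\<close> points.\<close>

lemma (in group) transitive_sylow:
  assumes act: "group_action G E \<phi>" and p: "Factorial_Ring.prime (p::nat)"
    and fin: "finite (carrier G)"
    and ord: "order G = p ^ a * m" "\<not> p dvd m" and E: "card E = p ^ n"
    and x: "x \<in> E" and trans: "orbit G \<phi> x = E"
    and P: "subgroup P G" "card P = p ^ a" and y: "y \<in> E"
  obtains g where "g \<in> P" "\<phi> g x = y"
proof -
  let ?P = "G\<lparr>carrier := P\<rparr>"
  interpret A: group_action G E \<phi> by fact
  interpret B: group_action ?P E \<phi> by (rule A.induced_action[OF P(1)])
  have finE: "finite E"
    using trans fin by (auto simp: orbit_def)
  have sub: "subgroup (stabilizer ?P \<phi> x) G"
    using B.stabilizer_subgroup[OF x] incl_subgroup[OF P(1)] by blast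
  have "stabilizer ?P \<phi> x \<subseteq> stabilizer G \<phi> x"
    using subgroup.subset[OF P(1)] by (auto simp: stabilizer_def)
  then have "subgroup (stabilizer ?P \<phi> x) (G\<lparr>carrier := stabilizer G \<phi> x\<rparr>)"
    using sub A.stabilizer_subgroup[OF x] by (rule_tac subgroup_incl) auto
  then have d: "card (stabilizer ?P \<phi> x) dvd card (stabilizer G \<phi> x)"
    using group.lagrange[OF subgroup.subgroup_is_group[OF A.stabilizer_subgroup[OF x] is_group]]
    by (metis dvd_triv_right order_def partial_object.select_convs(1) partial_object.update_convs(1)
        partial_object.surjective)
  have oP: "card (orbit ?P \<phi> x) * card (stabilizer ?P \<phi> x) = p ^ a"
    using B.orbit_stabilizer_theorem[OF x] P(2) by (simp add: order_def)
  then obtain b where b: "card (stabilizer ?P \<phi> x) = p ^ b"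
    using divides_primepow_nat[OF p] by (metis dvd_triv_right)
  have "p ^ (n + b) dvd p ^ n * card (stabilizer G \<phi> x)"
    using d b by (simp add: power_add)
  then have "p ^ (n + b) dvd m * p ^ a"
    using A.orbit_stabilizer_theorem[OF x] ord(1) trans E by (simp add: mult.commute)
  then have "p ^ (n + b) dvd p ^ a"
    using prime_power_dvd_multD[of p "n + b" m "p ^ a"] ord(2) p by (cases "n + b") auto
  then have "p ^ (n + b) \<le> p ^ a"
    using p by (intro dvd_imp_le) (auto simp: prime_gt_0_nat)
  then have "p ^ n * p ^ b \<le> card (orbit ?P \<phi> x) * p ^ b"
    using oP b by (simp add: power_add)
  then have "card E \<le> card (orbit ?P \<phi> x)"
    using E p by (simp add: prime_gt_0_nat)
  moreover have "orbit ?P \<phi> x \<subseteq> E"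
    using trans subgroup.subset[OF P(1)] by (auto simp: orbit_def)
  ultimately have "orbit ?P \<phi> x = E"
    using finE by (metis card_seteq)
  with y show thesis using that by (auto simp: orbit_def)
qed

section \<open>The operator \<phi> - 1 on an abelian p-group\<close>

text \<open>This is \<phi> - 1 in multiplicative notation; commutativity makes the quotient of two
  homomorphisms a homomorphism.\<close>

lemma (in comm_group) hom_minus_id:
  assumes "\<phi> \<in> hom G G"
  shows "(\<lambda>x. \<phi> x \<otimes> inv x) \<in> hom G G"
proof (rule homI)
  have cl: "\<phi> x \<in> carrier G" if "x \<in> carrier G" for x
    using assms that by (rule hom_in_carrier)
  show "\<phi> x \<otimes> inv x \<in> carrier G" if "x \<in> carrier G" for x
    using that cl by simp
  show "\<phi> (x \<otimes> y) \<otimes> inv (x \<otimes> y) = \<phi> x \<otimes> inv x \<otimes> (\<phi> y \<otimes> inv y)"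
    if "x \<in> carrier G" "y \<in> carrier G" for x y
    using that cl by (simp add: hom_mult[OF assms] inv_mult m_ac)
qed

text \<open>If \<open>B\<close> is nontrivial, \<phi> fixes a point of \<open>B\<close> other than
  the identity, so \<delta> is not injective on \<open>B\<close>, and its image, a subgroup of
  \<open>B\<close>, loses at least one factor p. The first two conclusions restore the hypotheses on
  \<open>B\<close>, so that the step can be iterated.\<close>

lemma (in comm_group) hom_minus_id_shrinks:
  fixes p :: nat
  assumes fin: "finite (carrier G)" and p: "Factorial_Ring.prime p" and \<phi>: "\<phi> \<in> hom G G"
    and per: "\<And>x. x \<in> carrier G \<Longrightarrow> (\<phi> ^^ (p ^ k)) x = x"
    and B: "subgroup B G" "\<phi> ` B \<subseteq> B" "card B dvd p ^ Suc j"
  defines "\<delta> \<equiv> \<lambda>x. \<phi> x \<otimes> inv x"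
  shows "subgroup (\<delta> ` B) G" "\<phi> ` (\<delta> ` B) \<subseteq> \<delta> ` B" "card (\<delta> ` B) dvd p ^ j"
proof -
  have \<delta>: "\<delta> \<in> hom G G"
    unfolding \<delta>_def by (rule hom_minus_id[OF \<phi>])
  have BG: "B \<subseteq> carrier G"
    by (rule subgroup.subset[OF B(1)])
  have finB: "finite B"
    using BG fin finite_subset by blast
  have oB: "\<one> \<in> B"
    by (rule subgroup.one_closed[OF B(1)])
  interpret D: group_hom G G \<delta>
    using \<delta> is_group by (simp add: group_hom_def group_hom_axioms_def)
  interpret F: group_hom G G \<phi>
    using \<phi> is_group by (simp add: group_hom_def group_hom_axioms_def)
  show sub: "subgroup (\<delta> ` B) G"
    by (rule D.subgroup_img_is_subgroup[OF B(1)])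
  have "\<phi> (\<delta> x) = \<delta> (\<phi> x)" if "x \<in> carrier G" for x
    using that by (simp add: \<delta>_def)
  then show "\<phi> ` (\<delta> ` B) \<subseteq> \<delta> ` B"
    using B(2) BG by (auto simp: image_iff subset_iff)
  have sB: "\<delta> ` B \<subseteq> B"
    using B(2) subgroup.m_closed[OF B(1)] subgroup.m_inv_closed[OF B(1)] by (auto simp: \<delta>_def)
  then have "subgroup (\<delta> ` B) (G\<lparr>carrier := B\<rparr>)"
    using sub B(1) by (rule_tac subgroup_incl) auto
  then have d: "card (\<delta> ` B) dvd card B"
    using group.lagrange[OF subgroup.subgroup_is_group[OF B(1) is_group], of "\<delta> ` B"]
    by (simp add: order_def) (metis dvd_triv_right)
  obtain i where i: "i \<le> Suc j" "card B = p ^ i"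
    using B(3) divides_primepow_nat[OF p] by blast
  show "card (\<delta> ` B) dvd p ^ j"
  proof (cases i)
    case 0
    then have "card (\<delta> ` B) = 1"
      using d i by simp
    then show ?thesis by simp
  next
    case (Suc i')
    obtain x where x: "x \<in> B" "x \<noteq> \<one>" "\<phi> x = x"
    proof (rule funpow_fixed_point_prime_power_period[OF p, of B \<phi> k \<one>])
      show "p dvd card B"
        using i Suc by simp
    qed (use B(2) BG per finB oB in auto)
    have "\<delta> x = \<delta> \<one>"
      using x BG by (auto simp: \<delta>_def)
    then have "\<not> inj_on \<delta> B"
      using x(1,2) oB by (meson inj_onD)
    then have "card (\<delta> ` B) \<noteq> card B"
      using finB eq_card_imp_inj_on by blast
    moreover obtain l where l: "l \<le> i" "card (\<delta> ` B) = p ^ l"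
      using d i divides_primepow_nat[OF p] by auto
    ultimately have "l \<le> j"
      using i by (cases "l = i") auto
    then show ?thesis
      using l by (simp add: le_imp_power_dvd)
  qed
qed

text \<open>This is where \<open>p > 3\<close> enters: for p = 3 the second coefficient is
  1.\<close>

lemma prime_dvd_choose_2_3:
  assumes "Factorial_Ring.prime (p::nat)" "p > 3"
  shows "p dvd p choose 2" "p dvd p choose 3"
  using assms by (auto intro!: dvd_choose_prime)

text \<open>The recursion makes \<open>w i\<close> the product of the first i iterates of x under \<open>\<phi>\<close>.\<close>

lemma (in comm_group) norm_sequence_eq_pow:
  fixes p :: nat
  assumes p: "Factorial_Ring.prime p" "p > 3" and ord: "order G = p ^ 3"
    and powers: "card ((\<lambda>x. x [^] p) ` carrier G) dvd p"
    and \<phi>: "\<phi> \<in> hom G G" and per: "\<And>x. x \<in> carrier G \<Longrightarrow> (\<phi> ^^ (p ^ k)) x = x"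
    and x: "x \<in> carrier G" and w: "w 0 = \<one>" "\<And>i. w (Suc i) = \<phi> (w i) \<otimes> x"
  shows "w p = x [^] p"
proof -
  have fin: "finite (carrier G)"
    using ord p by (metis order_gt_0_iff_finite prime_gt_0_nat zero_less_power)
  define \<delta> where "\<delta> = (\<lambda>x. \<phi> x \<otimes> inv x)"
  note shrink = hom_minus_id_shrinks[OF fin p(1) \<phi> per, folded \<delta>_def]
  interpret D: group_hom G G \<delta>
    using hom_minus_id[OF \<phi>] is_group
    by (simp add: group_hom_def group_hom_axioms_def \<delta>_def)
  interpret F: group_hom G G \<phi>
    using \<phi> is_group by (simp add: group_hom_def group_hom_axioms_def)
  have triv: "y = \<one>" if "subgroup B G" "card B dvd 1" "y \<in> B" for B y
  proof -
    have "card B = 1" using that(2) by simp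
    then obtain z where "B = {z}" by (rule card_1_singletonE)
    then show ?thesis using that subgroup.one_closed by blast
  qed
  have \<phi>_eq: "\<phi> y = \<delta> y \<otimes> y" if "y \<in> carrier G" for y
    using that by (simp add: \<delta>_def m_assoc)
  \<comment> \<open>Three rounds of shrinking start from the whole group of order
    \<open>p ^ 3\<close>. Exponents are written with \<open>Suc\<close> to match the shape of
    \<open>shrink\<close>.\<close>
  have \<delta>3: "\<delta> (\<delta> (\<delta> x)) = \<one>"
  proof -
    let ?B = "carrier G"
    have 0: "subgroup ?B G" "\<phi> ` ?B \<subseteq> ?B" "card ?B dvd p ^ Suc 2"
      using ord by (auto simp: subgroup_self order_def eval_nat_numeral)
    note 1 = shrink[OF _ 0]
    have 1: "subgroup (\<delta> ` ?B) G" "\<phi> ` \<delta> ` ?B \<subseteq> \<delta> ` ?B" "card (\<delta> ` ?B) dvd p ^ Suc 1"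
      using 1 by (auto simp: numeral_2_eq_2)
    note 2 = shrink[OF _ 1]
    have 2: "subgroup (\<delta> ` \<delta> ` ?B) G" "\<phi> ` \<delta> ` \<delta> ` ?B \<subseteq> \<delta> ` \<delta> ` ?B"
        "card (\<delta> ` \<delta> ` ?B) dvd p ^ Suc 0"
      using 2 by auto
    note 3 = shrink[OF _ 2]
    have 3: "subgroup (\<delta> ` \<delta> ` \<delta> ` ?B) G" "card (\<delta> ` \<delta> ` \<delta> ` ?B) dvd 1"
      using 3 by auto
    show ?thesis
      by (rule triv[OF 3]) (use x in blast)
  qed
  \<comment> \<open>One round of shrinking on the subgroup of p-th powers, whose order divides p,
    shows that \<delta> kills every \<open>y [^] p\<close>.\<close>
  have \<delta>p: "\<delta> y [^] p = \<one>" if y: "y \<in> carrier G" for y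
  proof -
    let ?B = "(\<lambda>x. x [^] p) ` carrier G"
    interpret Q: group_hom G G "\<lambda>x. x [^] p"
      using is_group by (simp add: group_hom_def group_hom_axioms_def hom_def nat_pow_distrib)
    have 0: "subgroup ?B G" "\<phi> ` ?B \<subseteq> ?B" "card ?B dvd p ^ Suc 0"
      using powers Q.subgroup_img_is_subgroup[OF subgroup_self] by (auto simp: F.hom_nat_pow)
    note 1 = shrink[OF _ 0]
    have 1: "subgroup (\<delta> ` ?B) G" "card (\<delta> ` ?B) dvd 1"
      using 1 by auto
    have "\<delta> (y [^] p) = \<one>"
      by (rule triv[OF 1]) (use y in blast)
    then show ?thesis
      using y by (simp add: D.hom_nat_pow)
  qed
  have cp: "\<delta> y [^] (p choose i) = \<one>" if y: "y \<in> carrier G" and d: "p dvd (p choose i)" for y i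
  proof -
    obtain q where "p choose i = p * q" using d by blast
    then show ?thesis
      using y by (simp add: \<delta>p flip: nat_pow_pow)
  qed
  \<comment> \<open>With \<phi> = 1 + \<delta>, the sum of the first i powers of \<phi> is the sum
    over j of (i choose j+1) times the j-th power of \<delta>; \<open>\<delta>3\<close> cuts it off
    after j = 2. The induction is Pascal's rule, and at \<open>i = p\<close> only the first factor
    survives.\<close>
  have "w i = x [^] i \<otimes> \<delta> x [^] (i choose 2) \<otimes> \<delta> (\<delta> x) [^] (i choose 3)" for i
  proof (induction i)
    case 0
    show ?case using x by (simp add: w binomial_eq_0)
  next
    case (Suc i)
    have c: "Suc i choose 2 = i + (i choose 2)" "Suc i choose 3 = (i choose 2) + (i choose 3)"
      by (simp_all add: numeral_2_eq_2 numeral_3_eq_3)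
    have 1: "\<phi> (x [^] i) = \<delta> x [^] i \<otimes> x [^] i"
      using x by (simp add: F.hom_nat_pow \<phi>_eq[of x] nat_pow_distrib)
    have 2: "\<phi> (\<delta> x [^] m) = \<delta> (\<delta> x) [^] m \<otimes> \<delta> x [^] m" for m :: nat
      using x by (simp add: F.hom_nat_pow \<phi>_eq[of "\<delta> x"] nat_pow_distrib)
    have 3: "\<phi> (\<delta> (\<delta> x) [^] m) = \<delta> (\<delta> x) [^] m" for m :: nat
      using x by (simp add: F.hom_nat_pow \<phi>_eq[of "\<delta> (\<delta> x)"] \<delta>3)
    have "w (Suc i) = (\<delta> x [^] i \<otimes> x [^] i) \<otimes> (\<delta> (\<delta> x) [^] (i choose 2) \<otimes> \<delta> x [^] (i choose 2))
        \<otimes> \<delta> (\<delta> x) [^] (i choose 3) \<otimes> x"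
      using x by (simp add: w Suc.IH 1 2 3)
    also have "\<dots> = (x [^] i \<otimes> x) \<otimes> (\<delta> x [^] i \<otimes> \<delta> x [^] (i choose 2))
        \<otimes> (\<delta> (\<delta> x) [^] (i choose 2) \<otimes> \<delta> (\<delta> x) [^] (i choose 3))"
      using x by (simp add: m_ac)
    also have "\<dots> = x [^] Suc i \<otimes> \<delta> x [^] (Suc i choose 2) \<otimes> \<delta> (\<delta> x) [^] (Suc i choose 3)"
      using x by (simp add: c nat_pow_mult)
    finally show ?case .
  qed
  then show ?thesis
    using x cp prime_dvd_choose_2_3[OF p] by simp
qed

section \<open>Elements normalizing a regular permutation group\<close>

text \<open>Since \<open>n = g \<otimes> inv h\<close>, the quotients of the i-th powers of
  \<open>g\<close> and \<open>h\<close> satisfy the recursion of the norm sequence of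
  \<open>n\<close> under conjugation by \<open>g\<close>. Its p-th term is therefore
  \<open>n [^] p\<close>.\<close>

lemma (in group) pow_mult_of_normalizing:
  fixes p :: nat
  assumes p: "Factorial_Ring.prime p" "p > 3"
    and N: "comm_group (G\<lparr>carrier := N\<rparr>)" "subgroup N G" "card N = p ^ 3"
      "card ((\<lambda>x. x [^] p) ` N) dvd p"
    and g: "g \<in> carrier G" "g [^] (p ^ k) = \<one>" "\<And>m. m \<in> N \<Longrightarrow> g \<otimes> m \<otimes> inv g \<in> N"
    and n: "n \<in> N" and h: "h \<in> carrier G" and eq: "g = n \<otimes> h"
  shows "g [^] p = n [^] p \<otimes> h [^] p"
proof -
  let ?N = "G\<lparr>carrier := N\<rparr>"
  interpret N: comm_group ?N by (rule N)
  have NG: "m \<in> carrier G" if "m \<in> N" for m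
    using subgroup.mem_carrier[OF N(2) that] .
  define \<phi> where "\<phi> m = g \<otimes> m \<otimes> inv g" for m
  \<comment> \<open>\<open>w i\<close> lies in N because g and h agree modulo N.\<close>
  define w where "w i = g [^] i \<otimes> inv (h [^] i)" for i :: nat
  have iter: "(\<phi> ^^ i) m = g [^] i \<otimes> m \<otimes> inv (g [^] i)" if "m \<in> carrier G" for m i
  proof (induction i)
    case (Suc i)
    have "g [^] Suc i = g \<otimes> g [^] i"
      using g(1) by (rule nat_pow_Suc2)
    then show ?case
      using that g(1) Suc.IH by (simp add: \<phi>_def inv_mult_group m_assoc del: nat_pow_Suc)
  qed (use that in simp)
  have "w p = n [^]\<^bsub>?N\<^esub> p"
  proof (rule N.norm_sequence_eq_pow[OF p])
    show "order ?N = p ^ 3"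
      using N by (simp add: order_def)
    show "card ((\<lambda>x. x [^]\<^bsub>?N\<^esub> p) ` carrier ?N) dvd p"
      using N(4) by (simp flip: nat_pow_consistent)
    show "\<phi> \<in> hom ?N ?N"
    proof (rule homI)
      fix x y assume "x \<in> carrier ?N" "y \<in> carrier ?N"
      then show "\<phi> (x \<otimes>\<^bsub>?N\<^esub> y) = \<phi> x \<otimes>\<^bsub>?N\<^esub> \<phi> y"
        using g(1) NG by (simp add: \<phi>_def m_assoc inv_solve_left)
    qed (use g in \<open>simp add: \<phi>_def\<close>)
    show "(\<phi> ^^ (p ^ k)) x = x" if "x \<in> carrier ?N" for x
      using that NG by (simp add: iter g(2))
    show "w 0 = \<one>\<^bsub>?N\<^esub>"
      by (simp add: w_def)
    show "w (Suc i) = \<phi> (w i) \<otimes>\<^bsub>?N\<^esub> n" for i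
    proof -
      have "n = g \<otimes> inv h"
        using eq h NG[OF n] by (simp add: m_assoc)
      moreover have "inv g \<otimes> (g \<otimes> inv h) = inv h"
        using g(1) h by (simp flip: m_assoc)
      ultimately have "\<phi> (w i) \<otimes> n = g \<otimes> g [^] i \<otimes> (inv (h [^] i) \<otimes> inv h)"
        using g(1) h by (simp add: \<phi>_def w_def m_assoc)
      also have "g \<otimes> g [^] i = g [^] Suc i"
        using nat_pow_Suc2[OF g(1)] by simp
      also have "inv (h [^] i) \<otimes> inv h = inv (h [^] Suc i)"
        using h nat_pow_Suc2[OF h] by (simp add: inv_mult_group del: nat_pow_Suc)
      finally show ?thesis by (simp add: w_def)
    qed
  qed (use n in simp)
  then have "n [^] p = g [^] p \<otimes> inv (h [^] p)"
    by (simp add: w_def flip: nat_pow_consistent)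
  then show ?thesis
    using g(1) h by (simp add: m_assoc)
qed

lemma BijGroup_simps:
  "carrier (BijGroup E) = Bij E"
  "x \<in> E \<Longrightarrow> \<one>\<^bsub>BijGroup E\<^esub> x = x"
  "\<lbrakk>f \<in> Bij E; g \<in> Bij E; x \<in> E\<rbrakk> \<Longrightarrow> (f \<otimes>\<^bsub>BijGroup E\<^esub> g) x = f (g x)"
  by (simp_all add: BijGroup_def compose_def)

lemma BijGroup_fixed_pow:
  assumes "f \<in> Bij E" "x \<in> E" "f x = x"
  shows "(f [^]\<^bsub>BijGroup E\<^esub> (n::nat)) x = x"
proof (induction n)
  case (Suc n)
  interpret group "BijGroup E" by (rule group_BijGroup)
  have "f [^]\<^bsub>BijGroup E\<^esub> n \<in> Bij E"
    using nat_pow_closed[of f n] assms by (simp add: BijGroup_simps)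
  then show ?case
    using Suc assms by (simp add: BijGroup_simps)
qed (use assms in \<open>simp add: BijGroup_simps\<close>)

lemma finite_Bij: "finite E \<Longrightarrow> finite (Bij E)"
  by (rule finite_subset[OF _ finite_PiE[of E "\<lambda>_. E"]])
    (auto simp: Bij_def PiE_def dest: bij_betw_imp_funcset)

lemma BijGroup_action: "group_action (BijGroup E) E (\<lambda>f. f)"
  by (simp add: group_action_def group_hom_def group_hom_axioms_def group_BijGroup hom_def)

text \<open>The element \<open>h = inv n \<otimes> g\<close> fixes \<open>x\<close>, and so does its
  p-th power; evaluate the factorization of the p-th power of \<open>g\<close> = \<open>n\<close>
  \<open>h\<close> at \<open>x\<close>.\<close>

lemma regular_subgroup_pow_eq:
  fixes p :: nat and E :: "'x set"
  defines "S \<equiv> BijGroup E"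
  assumes p: "Factorial_Ring.prime p" "p > 3"
    and N: "regular_subgroup N E" "comm_group (S\<lparr>carrier := N\<rparr>)" "card N = p ^ 3"
      "card ((\<lambda>x. x [^]\<^bsub>S\<^esub> p) ` N) dvd p"
    and g: "g \<in> Bij E" "g [^]\<^bsub>S\<^esub> (p ^ k) = \<one>\<^bsub>S\<^esub>" "\<And>m. m \<in> N \<Longrightarrow> g \<otimes>\<^bsub>S\<^esub> m \<otimes>\<^bsub>S\<^esub> inv\<^bsub>S\<^esub> g \<in> N"
    and n: "n \<in> N" "x \<in> E" "n x = g x"
  shows "(g [^]\<^bsub>S\<^esub> p) x = (n [^]\<^bsub>S\<^esub> p) x"
proof -
  interpret group S unfolding S_def by (rule group_BijGroup)
  have sub: "subgroup N S"
    using N(1) by (simp add: regular_subgroup_def S_def)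
  have nS: "n \<in> carrier S" and gS: "g \<in> carrier S"
    using subgroup.mem_carrier[OF sub n(1)] g(1) by (auto simp: S_def BijGroup_simps)
  define h where "h = inv\<^bsub>S\<^esub> n \<otimes>\<^bsub>S\<^esub> g"
  have hS: "h \<in> carrier S" and eq: "g = n \<otimes>\<^bsub>S\<^esub> h"
    using nS gS by (auto simp: h_def simp flip: m_assoc)
  have carr: "carrier S = Bij E"
    by (simp add: S_def BijGroup_simps)
  have "h x = x"
  proof -
    have hx: "h x \<in> E"
      using hS n(2) by (auto simp: carr dest: Bij_imp_funcset)
    have "n (h x) = n x"
      using eq n hS nS by (metis BijGroup_simps(3) S_def carr)
    moreover have "inj_on n E"
      using nS by (auto simp: carr Bij_def bij_betw_def)
    ultimately show ?thesis
      using hx n(2) by (auto dest: inj_onD)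
  qed
  then have "(h [^]\<^bsub>S\<^esub> p) x = x"
    using BijGroup_fixed_pow hS n(2) by (metis S_def carr)
  moreover have "g [^]\<^bsub>S\<^esub> p = n [^]\<^bsub>S\<^esub> p \<otimes>\<^bsub>S\<^esub> h [^]\<^bsub>S\<^esub> p"
    by (rule pow_mult_of_normalizing[OF p N(2) sub N(3,4) gS g(2,3) n(1) hS eq])
  moreover have "n [^]\<^bsub>S\<^esub> p \<in> Bij E" "h [^]\<^bsub>S\<^esub> p \<in> Bij E"
    using nS hS by (auto simp flip: carr)
  ultimately show ?thesis
    using n(2) by (simp add: S_def BijGroup_simps)
qed

text \<open>Some \<open>g\<close> in a Sylow p-subgroup of the common normalizer has
  \<open>g x = n x\<close>. Comparing \<open>g\<close> with \<open>N\<close> and with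
  \<open>N'\<close> computes the p-th power of \<open>g\<close> at \<open>x\<close> in two ways: as
  that of \<open>n\<close>, and as \<open>x\<close> itself.\<close>

lemma regular_subgroups_exponent:
  fixes p :: nat and E :: "'x set"
  defines "S \<equiv> BijGroup E"
  assumes p: "Factorial_Ring.prime p" "p > 3"
    and N: "regular_subgroup N E" "comm_group (S\<lparr>carrier := N\<rparr>)" "card N = p ^ 3"
      "card ((\<lambda>x. x [^]\<^bsub>S\<^esub> p) ` N) dvd p"
    and N': "regular_subgroup N' E" "comm_group (S\<lparr>carrier := N'\<rparr>)" "card N' = p ^ 3"
      "\<And>n. n \<in> N' \<Longrightarrow> n [^]\<^bsub>S\<^esub> p = \<one>\<^bsub>S\<^esub>"
    and x: "x \<in> E" and \<Gamma>: "\<Gamma> \<subseteq> Bij E" "\<And>y. y \<in> E \<Longrightarrow> \<exists>g\<in>\<Gamma>. g x = y"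
      "\<And>g. g \<in> \<Gamma> \<Longrightarrow> (\<lambda>m. g \<otimes>\<^bsub>S\<^esub> m \<otimes>\<^bsub>S\<^esub> inv\<^bsub>S\<^esub> g) ` N = N"
      "\<And>g. g \<in> \<Gamma> \<Longrightarrow> (\<lambda>m. g \<otimes>\<^bsub>S\<^esub> m \<otimes>\<^bsub>S\<^esub> inv\<^bsub>S\<^esub> g) ` N' = N'"
    and n: "n \<in> N"
  shows "n [^]\<^bsub>S\<^esub> p = \<one>\<^bsub>S\<^esub>"
proof -
  interpret S: group S unfolding S_def by (rule group_BijGroup)
  have carr: "carrier S = Bij E"
    by (simp add: S_def BijGroup_simps)
  have sub: "subgroup N S" "subgroup N' S"
    using N(1) N'(1) by (simp_all add: regular_subgroup_def S_def)
  have NE: "m x \<in> E" if "m \<in> N" for m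
    using that x subgroup.mem_carrier[OF sub(1)] carr by (auto dest: Bij_imp_funcset)
  \<comment> \<open>Evaluation at \<open>x\<close> transfers the order of \<open>N\<close> to
    \<open>E\<close>, which gives the prime power degree that \<open>transitive_sylow\<close> asks
    for.\<close>
  have "bij_betw (\<lambda>n. n x) N E"
    unfolding bij_betw_def
  proof
    show "inj_on (\<lambda>n. n x) N"
    proof (rule inj_onI)
      fix a b assume ab: "a \<in> N" "b \<in> N" "a x = b x"
      have "\<exists>!n. n \<in> N \<and> n x = a x"
        using N(1) x NE[OF ab(1)] unfolding regular_subgroup_def by blast
      then show "a = b" using ab by metis
    qed
    show "(\<lambda>n. n x) ` N = E"
      using N(1) x NE unfolding regular_subgroup_def by blast
  qed
  from bij_betw_same_card[OF this] have cE: "card E = p ^ 3"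
    using N(3) by simp
  then have finE: "finite E"
    using p by (intro card_ge_0_finite) simp
  then have finS: "finite (carrier S)"
    by (simp add: carr finite_Bij)
  have norm_iff: "normalizer S H = {g \<in> carrier S. (\<lambda>m. g \<otimes>\<^bsub>S\<^esub> m \<otimes>\<^bsub>S\<^esub> inv\<^bsub>S\<^esub> g) ` H = H}"
    if "H \<subseteq> carrier S" for H
  proof -
    have "g <#\<^bsub>S\<^esub> H #>\<^bsub>S\<^esub> inv\<^bsub>S\<^esub> g = (\<lambda>m. g \<otimes>\<^bsub>S\<^esub> m \<otimes>\<^bsub>S\<^esub> inv\<^bsub>S\<^esub> g) ` H" for g
      unfolding l_coset_def r_coset_def by blast
    then show ?thesis
      using that by (simp add: normalizer_def stabilizer_def)
  qed
  \<comment> \<open>Working in the whole common normalizer, which contains \<Gamma> and so is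
    transitive, turns membership into two conjugation conditions.\<close>
  define D where "D = normalizer S N \<inter> normalizer S N'"
  have NS: "N \<subseteq> carrier S" "N' \<subseteq> carrier S"
    using sub by (simp_all add: subgroup.subset)
  have D: "subgroup D S"
    unfolding D_def by (intro S.subgroups_Inter_pair S.normalizer_imp_subgroup NS)
  have D_eq: "D = {g \<in> Bij E. (\<lambda>m. g \<otimes>\<^bsub>S\<^esub> m \<otimes>\<^bsub>S\<^esub> inv\<^bsub>S\<^esub> g) ` N = N \<and>
      (\<lambda>m. g \<otimes>\<^bsub>S\<^esub> m \<otimes>\<^bsub>S\<^esub> inv\<^bsub>S\<^esub> g) ` N' = N'}"
    unfolding D_def norm_iff[OF NS(1)] norm_iff[OF NS(2)] carr by blast
  have \<Gamma>D: "\<Gamma> \<subseteq> D"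
    unfolding D_eq using \<Gamma> by blast
  let ?D = "S\<lparr>carrier := D\<rparr>"
  interpret D: group ?D
    by (rule subgroup.subgroup_is_group[OF D S.is_group])
  have act: "group_action ?D E (\<lambda>f. f)"
    using group_action.induced_action[OF BijGroup_action] D by (simp add: S_def)
  have finD: "finite D"
    using finS D by (meson finite_subset subgroup.subset)
  have "order ?D > 0"
    using D.order_gt_0_iff_finite finD by simp
  then obtain a m where am: "order ?D = p ^ a * m" "\<not> p dvd m"
    using p(1) by (metis multiplicity_decompose' not_prime_unit bot_nat_0.not_eq_extremum)
  obtain P where P: "subgroup P ?D" "card P = p ^ a"
    using sylow_thm[OF p(1) D.is_group am(1)] finD by auto
  have PD: "P \<subseteq> D"
    using subgroup.subset[OF P(1)] by simp
  have trans: "orbit ?D (\<lambda>f. f) x = E"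
  proof
    show "orbit ?D (\<lambda>f. f) x \<subseteq> E"
      using x subgroup.subset[OF D] by (auto simp: orbit_def carr dest: Bij_imp_funcset)
    show "E \<subseteq> orbit ?D (\<lambda>f. f) x"
      using \<Gamma>(2) \<Gamma>D by (fastforce simp: orbit_def)
  qed
  have nE: "n x \<in> E"
    by (rule NE[OF n])
  obtain g where g: "g \<in> P" "g x = n x"
    using D.transitive_sylow[OF act p(1) _ am cE x trans P nE] finD by auto
  have gS: "g \<in> Bij E"
    using g(1) PD D[THEN subgroup.subset] carr by blast
  \<comment> \<open>This gives conjugation by \<open>g\<close> its p-power period, the reason for
    passing to a Sylow subgroup.\<close>
  have gk: "g [^]\<^bsub>S\<^esub> (p ^ a) = \<one>\<^bsub>S\<^esub>"
  proof -
    have "subgroup P S"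
      using P(1) D S.incl_subgroup by blast
    then have "g [^]\<^bsub>S\<lparr>carrier := P\<rparr>\<^esub> order (S\<lparr>carrier := P\<rparr>) = \<one>\<^bsub>S\<lparr>carrier := P\<rparr>\<^esub>"
      using group.pow_order_eq_1[OF subgroup.subgroup_is_group[OF _ S.is_group]] g(1) by force
    then show ?thesis
      using P(2) by (simp add: order_def flip: S.nat_pow_consistent)
  qed
  have gN: "g \<otimes>\<^bsub>S\<^esub> m \<otimes>\<^bsub>S\<^esub> inv\<^bsub>S\<^esub> g \<in> N" if "m \<in> N" for m
    using that g(1) PD unfolding D_eq by blast
  have gN': "g \<otimes>\<^bsub>S\<^esub> m \<otimes>\<^bsub>S\<^esub> inv\<^bsub>S\<^esub> g \<in> N'" if "m \<in> N'" for m
    using that g(1) PD unfolding D_eq by blast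
  have "(n [^]\<^bsub>S\<^esub> p) x = (g [^]\<^bsub>S\<^esub> p) x"
    using regular_subgroup_pow_eq[OF p N[unfolded S_def] gS gk[unfolded S_def] gN[unfolded S_def] n x]
      g(2) by (simp add: S_def)
  also have "\<dots> = x"
  proof -
    have "g x \<in> E" using g(2) nE by simp
    then obtain n' where n': "n' \<in> N'" "n' x = g x"
      using N'(1) x unfolding regular_subgroup_def by blast
    \<comment> \<open>A single p-th power meets the divisibility condition, since 1 divides p; so
      the same lemma serves both groups.\<close>
    have "(\<lambda>x. x [^]\<^bsub>S\<^esub> p) ` N' = {\<one>\<^bsub>S\<^esub>}"
      using N'(4) n'(1) by auto
    then have "card ((\<lambda>x. x [^]\<^bsub>S\<^esub> p) ` N') dvd p" by simp
    then have "(g [^]\<^bsub>S\<^esub> p) x = (n' [^]\<^bsub>S\<^esub> p) x"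
      using regular_subgroup_pow_eq[OF p N'(1-3)[unfolded S_def] _ gS gk[unfolded S_def] gN'[unfolded S_def] n'(1) x n'(2)]
      by (simp add: S_def)
    then show ?thesis
      using N'(4)[OF n'(1)] x by (simp add: S_def BijGroup_simps)
  qed
  finally have "(n [^]\<^bsub>S\<^esub> p) x = \<one>\<^bsub>S\<^esub> x"
    using x by (simp add: S_def BijGroup_simps)
  \<comment> \<open>By regularity, elements of \<open>N\<close> that agree at \<open>x\<close> are
    equal.\<close>
  moreover have "n [^]\<^bsub>S\<^esub> p \<in> N" "\<one>\<^bsub>S\<^esub> \<in> N"
    using n sub(1) monoid.nat_pow_closed[OF group.is_monoid[OF subgroup.subgroup_is_group[OF sub(1) S.is_group]], of n p]
    by (simp_all add: subgroup.one_closed flip: S.nat_pow_consistent)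
  ultimately show ?thesis
    using N(1) x unfolding regular_subgroup_def S_def
    by (metis BijGroup_simps(2))
qed

section \<open>Powers in the two abelian types\<close>

lemma DirProd_nat_pow:
  "(a, b) [^]\<^bsub>G \<times>\<times> H\<^esub> (n::nat) = (a [^]\<^bsub>G\<^esub> n, b [^]\<^bsub>H\<^esub> n)"
  by (induction n) (simp_all add: DirProd_def nat_pow_def)

lemma DirProd_comm_group:
  assumes "comm_group G" "comm_group H"
  shows "comm_group (G \<times>\<times> H)"
proof -
  interpret G: comm_group G by fact
  interpret H: comm_group H by fact
  interpret group "G \<times>\<times> H"
    by (rule DirProd_group) unfold_locales
  show ?thesis
    by (rule group_comm_groupI) (auto simp: G.m_comm H.m_comm)
qed

lemma iso_comm_group:
  assumes "G \<cong> H" "group G" "comm_group H"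
  shows "comm_group G"
  using comm_group.iso_imp_comm_group[OF assms(3) group.iso_sym[OF assms(2,1)]] assms(2)
  by (simp add: group.is_monoid)

text \<open>The number of p-th powers is the invariant that separates the two types: it is p for one
  and 1 for the other.\<close>

lemma iso_card_powers:
  assumes "G \<cong> H" "group G" "group H"
  shows "card ((\<lambda>x. x [^]\<^bsub>G\<^esub> (n::nat)) ` carrier G) = card ((\<lambda>x. x [^]\<^bsub>H\<^esub> n) ` carrier H)"
proof -
  obtain f where f: "f \<in> iso G H"
    using assms(1) by (auto simp: is_iso_def)
  then have bij: "bij_betw f (carrier G) (carrier H)" and hom: "f \<in> hom G H"
    by (auto simp: iso_def)
  interpret group_hom G H f
    using hom assms by (simp add: group_hom_def group_hom_axioms_def)
  have "(\<lambda>x. x [^]\<^bsub>H\<^esub> n) ` carrier H = (\<lambda>x. x [^]\<^bsub>H\<^esub> n) ` f ` carrier G"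
    using bij by (simp add: bij_betw_def)
  also have "\<dots> = f ` (\<lambda>x. x [^]\<^bsub>G\<^esub> n) ` carrier G"
    unfolding image_image by (rule image_cong) (simp_all add: hom_nat_pow)
  finally have *: "(\<lambda>x. x [^]\<^bsub>H\<^esub> n) ` carrier H = f ` (\<lambda>x. x [^]\<^bsub>G\<^esub> n) ` carrier G" .
  show ?thesis
    unfolding * by (rule card_image[symmetric], rule inj_on_subset[of f "carrier G"])
      (use bij in \<open>auto simp: bij_betw_def\<close>)
qed

lemma card_carrier_integer_mod_group: "n > 0 \<Longrightarrow> card (carrier (integer_mod_group n)) = n"
  by (simp add: carrier_integer_mod_group)

lemma powers_elementary_abelian:
  fixes p :: nat
  assumes "p > 0"
  shows "(\<lambda>x. x [^]\<^bsub>integer_mod_group p \<times>\<times> integer_mod_group p \<times>\<times> integer_mod_group p\<^esub> p) `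
      carrier (integer_mod_group p \<times>\<times> integer_mod_group p \<times>\<times> integer_mod_group p) = {(0, 0, 0)}"
  (is "?f ` ?C = _")
proof -
  have "?f x = (0, 0, 0)" if "x \<in> ?C" for x
    using that by (cases x) (auto simp: DirProd_nat_pow)
  then have "?f ` ?C = (\<lambda>_. (0, 0, 0)) ` ?C"
    by (rule image_cong[OF refl])
  also have "\<dots> = {(0, 0, 0)}"
    by (rule image_constant[of "(0, 0, 0)"]) simp
  finally show ?thesis .
qed

text \<open>Multiplication by p kills the second factor, and modulo \<open>p\<^sup>2\<close> the
  value of p times a depends only on a modulo p.\<close>

lemma card_powers_prime_square_times_prime:
  fixes p :: nat
  assumes "p > 0"
  shows "card ((\<lambda>x. x [^]\<^bsub>integer_mod_group (p\<^sup>2) \<times>\<times> integer_mod_group p\<^esub> p) `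
      carrier (integer_mod_group (p\<^sup>2) \<times>\<times> integer_mod_group p)) = p"
proof -
  let ?T = "integer_mod_group (p\<^sup>2) \<times>\<times> integer_mod_group p"
  have pow: "(a, b) [^]\<^bsub>?T\<^esub> p = (int p * (a mod int p), 0)" if "(a, b) \<in> carrier ?T" for a b
    using that by (simp add: DirProd_nat_pow power2_eq_square)
  \<comment> \<open>These are the preimages that show every listed value to be a p-th power.\<close>
  have mem: "(i, 0) \<in> carrier ?T" if "i \<in> {0..<int p}" for i
  proof -
    have "int p \<le> int p * int p"
      using assms by (simp add: mult_le_cancel_left1)
    moreover have "i < int p"
      using that by simp
    ultimately have "i < int p * int p"
      by (rule less_le_trans[rotated])
    then have "i < int p * int p"
      using that by simp
    then show ?thesis
      using that assms by (auto simp: carrier_integer_mod_group power2_eq_square)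
  qed
  have "(\<lambda>x. x [^]\<^bsub>?T\<^esub> p) ` carrier ?T = (\<lambda>i. (int p * i, 0)) ` {0..<int p}"
  proof
    show "(\<lambda>x. x [^]\<^bsub>?T\<^esub> p) ` carrier ?T \<subseteq> (\<lambda>i. (int p * i, 0)) ` {0..<int p}"
    proof
      fix y assume "y \<in> (\<lambda>x. x [^]\<^bsub>?T\<^esub> p) ` carrier ?T"
      then obtain a b where "(a, b) \<in> carrier ?T" "y = (a, b) [^]\<^bsub>?T\<^esub> p"
        by auto
      then have "y = (int p * (a mod int p), 0)"
        using pow by simp
      then show "y \<in> (\<lambda>i. (int p * i, 0)) ` {0..<int p}"
        using assms by (intro image_eqI[of _ _ "a mod int p"]) auto
    qed
    show "(\<lambda>i. (int p * i, 0)) ` {0..<int p} \<subseteq> (\<lambda>x. x [^]\<^bsub>?T\<^esub> p) ` carrier ?T"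
    proof
      fix y assume "y \<in> (\<lambda>i. (int p * i, 0::int)) ` {0..<int p}"
      then obtain i where i: "i \<in> {0..<int p}" "y = (int p * i, 0)"
        by auto
      then have "y = (i, 0) [^]\<^bsub>?T\<^esub> p"
        using pow[OF mem[OF i(1)]] by simp
      then show "y \<in> (\<lambda>x. x [^]\<^bsub>?T\<^esub> p) ` carrier ?T"
        using mem[OF i(1)] by blast
    qed
  qed
  moreover have "inj_on (\<lambda>i. (int p * i, 0::int)) {0..<int p}"
    using assms by (auto intro: inj_onI)
  ultimately show ?thesis
    by (simp add: card_image)
qed

section \<open>The Galois group and its action on cosets\<close>

text \<open>For \<open>F = K\<close> this makes \<open>galois_group M K\<close> a group.\<close>

lemma galois_set_subgroup:
  assumes "ring M" "F \<subseteq> carrier M"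
  shows "subgroup (galois_set M F) (BijGroup (carrier M))"
proof (rule subgroup.intro)
  interpret ring M by fact
  note bij = Bij_def bij_betw_def
  show "galois_set M F \<subseteq> carrier (BijGroup (carrier M))"
    by (auto simp: galois_set_def BijGroup_simps)
  show "\<one>\<^bsub>BijGroup (carrier M)\<^esub> \<in> galois_set M F"
    using assms(2) by (auto simp: galois_set_def BijGroup_def id_Bij ring_hom_def)
  fix \<sigma> assume \<sigma>: "\<sigma> \<in> galois_set M F"
  then have \<sigma>': "\<sigma> \<in> Bij (carrier M)" "\<sigma> \<in> ring_hom M M"
    by (auto simp: galois_set_def)
  note h = ring_hom_closed[OF \<sigma>'(2)] ring_hom_add[OF \<sigma>'(2)] ring_hom_mult[OF \<sigma>'(2)] ring_hom_one[OF \<sigma>'(2)]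
  show "\<sigma> \<otimes>\<^bsub>BijGroup (carrier M)\<^esub> \<tau> \<in> galois_set M F" if "\<tau> \<in> galois_set M F" for \<tau>
  proof -
    have \<tau>: "\<tau> \<in> Bij (carrier M)" "\<tau> \<in> ring_hom M M" "\<And>x. x \<in> F \<Longrightarrow> \<tau> x = x"
      using that by (auto simp: galois_set_def)
    note ring_hom_closed[OF \<tau>(2)] ring_hom_add[OF \<tau>(2)] ring_hom_mult[OF \<tau>(2)] ring_hom_one[OF \<tau>(2)]
    then have "compose (carrier M) \<sigma> \<tau> \<in> ring_hom M M"
      by (intro ring_hom_memI) (simp_all add: compose_def h)
    then show ?thesis
      using \<sigma> \<tau> assms(2) by (auto simp: galois_set_def BijGroup_def compose_Bij compose_eq subset_iff)
  qed
  have inv: "inv\<^bsub>BijGroup (carrier M)\<^esub> \<sigma> = (\<lambda>x\<in>carrier M. inv_into (carrier M) \<sigma> x)"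
    by (rule inv_BijGroup[OF \<sigma>'(1)])
  have inj: "inj_on \<sigma> (carrier M)" and surj: "\<sigma> ` carrier M = carrier M"
    using \<sigma>'(1) by (auto simp: bij)
  \<comment> \<open>Each homomorphism law for the inverse reduces to the same law for \<sigma> by
    uniqueness of preimages.\<close>
  have eqI: "inv_into (carrier M) \<sigma> y = x" if "x \<in> carrier M" "\<sigma> x = y" for x y
    using inv_into_f_f[OF inj that(1)] that(2) by simp
  let ?i = "inv_into (carrier M) \<sigma>"
  have i: "?i x \<in> carrier M" "\<sigma> (?i x) = x" if "x \<in> carrier M" for x
    using that surj by (auto intro: inv_into_into f_inv_into_f)
  have "restrict ?i (carrier M) \<in> ring_hom M M"
    by (intro ring_hom_memI) (simp_all add: i h eqI)
  moreover have "?i x = x" if "x \<in> F" for x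
    using that assms(2) \<sigma> by (intro eqI) (auto simp: galois_set_def)
  ultimately show "inv\<^bsub>BijGroup (carrier M)\<^esub> \<sigma> \<in> galois_set M F"
    unfolding inv using restrict_inv_into_Bij[OF \<sigma>'(1)] assms(2) by (auto simp: galois_set_def)
qed

text \<open>Translation by \<open>inv g\<close> is the inverse map.\<close>

lemma (in group) lcosets_translation_Bij:
  assumes H: "H \<subseteq> carrier G" and g: "g \<in> carrier G"
  shows "(\<lambda>C\<in>lcosets H. g <# C) \<in> Bij (lcosets H)"
proof -
  have mem: "a <# C \<in> lcosets H" "C \<subseteq> carrier G" if a: "a \<in> carrier G" and C: "C \<in> lcosets H" for a C
  proof -
    obtain b where b: "b \<in> carrier G" "C = b <# H"
      using C by (auto simp: LCOSETS_def)
    then show "C \<subseteq> carrier G"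
      using H by (simp add: l_coset_subset_G)
    have "a <# C = (a \<otimes> b) <# H"
      using b a H by (simp add: lcos_m_assoc)
    then show "a <# C \<in> lcosets H"
      using a b by (auto simp: LCOSETS_def)
  qed
  have "bij_betw (\<lambda>C\<in>lcosets H. g <# C) (lcosets H) (lcosets H)"
    by (rule bij_betw_byWitness[where f' = "\<lambda>C. inv g <# C"])
      (use mem g in \<open>auto simp: lcos_m_assoc lcos_mult_one\<close>)
  then show ?thesis
    by (simp add: Bij_def)
qed

theorem theorem8:
  fixes M :: "('a, 'm) ring_scheme" and K L :: "'a set" and p :: nat
  assumes "Factorial_Ring.prime p" and "p > 3"
    and "field M" and "subfield K M" and "subfield L M" and "K \<subseteq> L"
    and "is_normal_closure M K L"
    and "separable_extension M K L"
    and "ring.dimension M (p ^ 3) K L"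
    and "has_hopf_galois_structure_of_type TYPE('h\<^sub>1) M K L
           (integer_mod_group (p ^ 2) \<times>\<times> integer_mod_group p)"
  shows "\<not> has_hopf_galois_structure_of_type TYPE('h\<^sub>2) M K L
           (integer_mod_group p \<times>\<times> integer_mod_group p \<times>\<times> integer_mod_group p)"
proof
  let ?Z = integer_mod_group
  let ?T = "?Z (p ^ 2) \<times>\<times> ?Z p" and ?T' = "?Z p \<times>\<times> ?Z p \<times>\<times> ?Z p"
  let ?E = "coset_space M K L" and ?G = "galois_group M K" and ?S = "coset_perms M K L"
  assume "has_hopf_galois_structure_of_type TYPE('h\<^sub>2) M K L ?T'"
  \<comment> \<open>Each type is witnessed by a regular normalized subgroup, so both structures
    yield subgroups of one permutation group.\<close>
  with assms(10) obtain N N' where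
    N: "regular_subgroup N ?E" "normalized_by_galois M K L N" "?S\<lparr>carrier := N\<rparr> \<cong> ?T" and
    N': "regular_subgroup N' ?E" "normalized_by_galois M K L N'" "?S\<lparr>carrier := N'\<rparr> \<cong> ?T'"
    unfolding has_hopf_galois_structure_of_type_def has_type_def by blast
  interpret M: field M by fact
  interpret S: group ?S by (rule group_BijGroup)
  have KL: "K \<subseteq> carrier M" "L \<subseteq> carrier M"
    using subfieldE(3) assms(4,5) by blast+
  interpret G: group ?G
    unfolding galois_group_def
    by (rule subgroup.subgroup_is_group[OF galois_set_subgroup[OF M.ring_axioms KL(1)] group_BijGroup])
  let ?H = "galois_set M L"
  have carG: "carrier ?G = galois_set M K"
    by (simp add: galois_group_def)
  have HG: "?H \<subseteq> carrier ?G"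
    using assms(6) by (auto simp: carG galois_set_def)
  have E: "?E = lcosets\<^bsub>?G\<^esub> ?H"
    by (simp add: coset_space_def)
  \<comment> \<open>The trivial coset serves as the base point \<open>x\<close>.\<close>
  have HE: "?H \<in> ?E"
    unfolding E LCOSETS_def using G.lcos_mult_one[OF HG] by blast
  let ?\<Gamma> = "left_translation M K L ` galois_set M K"
  have \<Gamma>: "?\<Gamma> \<subseteq> Bij ?E"
    using G.lcosets_translation_Bij[OF HG] by (auto simp: left_translation_def E carG)
  have trans: "\<exists>g\<in>?\<Gamma>. g ?H = C" if "C \<in> ?E" for C
    using that HE by (auto simp: left_translation_def LCOSETS_def carG E)
  have grp: "group (?S\<lparr>carrier := N\<rparr>)" "group (?S\<lparr>carrier := N'\<rparr>)"
    using N(1) N'(1) subgroup.subgroup_is_group[OF _ S.is_group] by (auto simp: regular_subgroup_def)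
  have comm: "comm_group ?T" "comm_group ?T'"
    by (simp_all add: DirProd_comm_group)
  have p0: "p > 0"
    using assms(2) by simp
  have powers: "card ((\<lambda>x. x [^]\<^bsub>?S\<^esub> p) ` N) = p"
    using iso_card_powers[OF N(3) grp(1), of p] card_powers_prime_square_times_prime[OF p0] comm
    by (simp add: comm_group.axioms(2) flip: S.nat_pow_consistent)
  have "card ((\<lambda>x. x [^]\<^bsub>?S\<^esub> p) ` N') = 1"
    using iso_card_powers[OF N'(3) grp(2), of p] powers_elementary_abelian[OF p0] comm
    by (simp add: comm_group.axioms(2) flip: S.nat_pow_consistent)
  \<comment> \<open>The only p-th power must be the identity, because the identity is its own p-th
    power.\<close>
  then obtain z where z: "(\<lambda>x. x [^]\<^bsub>?S\<^esub> p) ` N' = {z}"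
    by (rule card_1_singletonE)
  have powers': "n [^]\<^bsub>?S\<^esub> p = \<one>\<^bsub>?S\<^esub>" if "n \<in> N'" for n
  proof -
    have "\<one>\<^bsub>?S\<^esub> \<in> N'"
      using N'(1) by (auto simp: regular_subgroup_def subgroup.one_closed)
    then have "\<one>\<^bsub>?S\<^esub> [^]\<^bsub>?S\<^esub> p = z" "n [^]\<^bsub>?S\<^esub> p = z"
      using z that by blast+
    then show ?thesis by simp
  qed
  have card: "card N = p ^ 3" "card N' = p ^ 3"
    using iso_same_card[OF N(3)] iso_same_card[OF N'(3)] p0
    by (simp_all add: card_cartesian_product card_carrier_integer_mod_group eval_nat_numeral)
  have conj: "(\<lambda>m. g \<otimes>\<^bsub>?S\<^esub> m \<otimes>\<^bsub>?S\<^esub> inv\<^bsub>?S\<^esub> g) ` B = B"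
    if "g \<in> ?\<Gamma>" "normalized_by_galois M K L B" for g B
    using that unfolding normalized_by_galois_def translation_conj_def by auto
  have "n [^]\<^bsub>?S\<^esub> p = \<one>\<^bsub>?S\<^esub>" if "n \<in> N" for n
  proof (rule regular_subgroups_exponent[OF assms(1,2) N(1) _ card(1) _ N'(1) _ card(2) _ HE \<Gamma>])
    show "comm_group (?S\<lparr>carrier := N\<rparr>)" "comm_group (?S\<lparr>carrier := N'\<rparr>)"
      using iso_comm_group N(3) N'(3) grp comm by blast+
  qed (use powers powers' trans conj N(2) N'(2) that in auto)
  \<comment> \<open>Exponent p leaves one p-th power in \<open>N\<close>, whereas its type provides
    p of them.\<close>
  then have "(\<lambda>x. x [^]\<^bsub>?S\<^esub> p) ` N \<subseteq> {\<one>\<^bsub>?S\<^esub>}"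
    by blast
  from card_mono[OF _ this] have "p \<le> 1"
    using powers by simp
  then show False
    using assms(2) by simp
qed

end
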